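(* For every subset $M\subset\mathbb{R}^2$, the set $\mathrm{PE}(M)$ of P-exceptional directions for $M$ is a meager subset of $\mathbb{T}=[0,2\pi)$ of Lebesgue measure $0$.
   Context: Let $\mathbb{T}=[0,2\pi)$, and for $\alpha\in\mathbb{T}$ define $\Phi_\alpha:\mathbb{R}^2\to\mathbb{R}$ by $\Phi_\alpha(x_1,x_2)=x_1\cos\alpha+x_2\sin\alpha$. For $M\subset\mathbb{R}^2$ put $\mathrm{PB}(M)=\{\alpha\in\mathbb{T} : \Phi_\alpha^{-1}(J)\cap M\text{ is bounded in }\mathbb{R}^2\text{ for every bounded subset }J\subset\mathbb{R}\}$ (P-bounded directions), $\mathrm{PUB}(M)=\{\alpha\in\mathbb{T} : \Phi_\alpha^{-1}(J)\cap M\text{ is unbounded in }\mathbb{R}^2\text{ for every open non-empty subset }J\subset\mathbb{R}\}$ (P-unbounded directions), and $\mathrm{PE}(M)=\mathbb{T}\setminus(\mathrm{PB}(M)\cup\mathrm{PUB}(M))$ (P-exceptional directions). *)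

theory Defs
  imports "HOL-Analysis.Analysis"
begin

definition directions :: "real set" where
  "directions = {0..<2 * pi}"

definition proj :: "real \<Rightarrow> real ^ 2 \<Rightarrow> real" where
  "proj \<alpha> x = x $ 1 * cos \<alpha> + x $ 2 * sin \<alpha>"

definition PB :: "(real ^ 2) set \<Rightarrow> real set" where
  "PB M = {\<alpha> \<in> directions. \<forall>J. bounded J \<longrightarrow> bounded (proj \<alpha> -` J \<inter> M)}"

definition PUB :: "(real ^ 2) set \<Rightarrow> real set" where
  "PUB M = {\<alpha> \<in> directions. \<forall>J. open J \<and> J \<noteq> {} \<longrightarrow> \<not> bounded (proj \<alpha> -` J \<inter> M)}"

definition PE :: "(real ^ 2) set \<Rightarrow> real set" where
  "PE M = directions - (PB M \<union> PUB M)"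

(* closure_of X A only sees A \<inter> topspace X, so the inclusion has to be required separately. *)
definition nowhere_dense_in :: "'a topology \<Rightarrow> 'a set \<Rightarrow> bool" where
  "nowhere_dense_in X A \<longleftrightarrow> A \<subseteq> topspace X \<and> X interior_of (X closure_of A) = {}"

definition meager_in :: "'a topology \<Rightarrow> 'a set \<Rightarrow> bool" where
  "meager_in X A \<longleftrightarrow> (\<exists>\<F>. countable \<F> \<and> (\<forall>B\<in>\<F>. nowhere_dense_in X B) \<and> A = \<Union>\<F>)"

end

theory Submission
  imports Defs
begin

text \<open>
  A direction is exceptional iff, for some rational data, some strip \<open>\<bar>proj \<alpha> x\<bar> \<le> K\<close> meets \<open>M\<close> in
  an unbounded set while the strip over some interval \<open>(a, b)\<close> meets \<open>M\<close> only inside a fixed ball.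
  At such an \<open>\<alpha>\<close>, every far point \<open>x\<close> of the first strip forbids all directions \<open>\<beta>\<close> with
  \<open>proj \<beta> x \<in> (a, b)\<close>; these form an interval whose length and whose distance from \<open>\<alpha>\<close> are both of
  order \<open>1 / norm x\<close>. So each of the countably many pieces is porous, hence nowhere dense, and null by
  the Vitali covering theorem.
\<close>

section \<open>Porous sets are nowhere dense and null\<close>

text \<open>The constant \<open>c\<close> is the same at all points and scales, which the volume
  count below relies on. The scales \<open>d\<close> only have to be arbitrarily small, not all
  small ones, so this is upper porosity.\<close>

definition porous :: "real \<Rightarrow> 'a::metric_space set \<Rightarrow> bool" where
  "porous c S \<longleftrightarrow> (\<forall>x\<in>S. \<forall>r>0. \<exists>d y. 0 < d \<and> d < r \<and> ball y (c * d) \<subseteq> ball x d - S)"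

lemma porous_subset:
  assumes "porous c S" "T \<subseteq> S"
  shows "porous c T"
  using assms unfolding porous_def by (meson Diff_mono order_refl order_trans subsetD)

text \<open>A nonempty open subset of the closure contains a point of \<open>S\<close> itself. A
  small enough hole near that point would be an open ball inside the closure that misses
  \<open>S\<close>, which is impossible.\<close>

lemma porous_imp_interior_closure_empty:
  assumes "porous c S" "0 < c"
  shows "interior (closure S) = {}"
proof (rule ccontr)
  assume "interior (closure S) \<noteq> {}"
  then have "interior (closure S) \<inter> closure S \<noteq> {}"
    using interior_subset by fastforce
  then obtain x where x: "x \<in> S" "x \<in> interior (closure S)"
    using open_Int_closure_eq_empty[OF open_interior] by blast
  then obtain r where r: "r > 0" "ball x r \<subseteq> interior (closure S)"
    using open_contains_ball open_interior by blast
  then obtain d y where d: "0 < d" "d < r" "ball y (c * d) \<subseteq> ball x d - S"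
    using assms(1) x(1) unfolding porous_def by blast
  have y: "y \<in> ball y (c * d)"
    using d assms(2) by simp
  then have "y \<in> closure S"
    using d r interior_subset subset_ball[of d r x] by fastforce
  then have "ball y (c * d) \<inter> S \<noteq> {}"
    using y open_Int_closure_eq_empty[OF open_ball] by blast
  then show False
    using d by blast
qed

lemma lmeasurable_outer_open:
  fixes S :: "'a::euclidean_space set"
  assumes S: "S \<in> lmeasurable" and "e > 0"
  obtains T where "open T" "S \<subseteq> T" "T \<in> lmeasurable"
    "measure lebesgue T < measure lebesgue S + e"
proof -
  obtain T where T: "open T" "S \<subseteq> T" "T - S \<in> lmeasurable" "emeasure lebesgue (T - S) < ennreal e"
    using sets_lebesgue_outer_open[OF fmeasurableD[OF S] \<open>e > 0\<close>] by blast
  have "measure lebesgue (T - S) < e"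
    using T(4) \<open>e > 0\<close> by (simp add: emeasure_eq_measure2[OF T(3)] ennreal_less_iff)
  moreover have "T = S \<union> (T - S)"
    using T by blast
  then have "T \<in> lmeasurable" "measure lebesgue T \<le> measure lebesgue S + measure lebesgue (T - S)"
    using fmeasurable.Un[OF S T(3)] measure_Un_le[OF fmeasurableD[OF S] fmeasurableD[OF T(3)]]
    by auto
  ultimately show thesis
    using that T by auto
qed

text \<open>Small balls inside \<open>V\<close> that carry a hole form a Vitali cover of
  \<open>S\<close>. A disjoint countable subfamily covers \<open>S\<close> up to a null set, and
  cutting out its holes removes the fixed fraction \<open>c ^ DIM('a)\<close> of its volume. The
  margin \<open>e\<close> pays for making the remainder open again, so that the step can be
  repeated.\<close>

lemma porous_outer_step:
  fixes S :: "'a::euclidean_space set"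
  assumes S: "porous c S" "0 < c" "c \<le> 1"
    and V: "open V" "V \<in> lmeasurable" "S \<subseteq> V" and "e > 0"
  obtains V' where "open V'" "V' \<in> lmeasurable" "S \<subseteq> V'"
    "measure lebesgue V' \<le> (1 - c ^ DIM('a)) * measure lebesgue V + e"
proof -
  let ?k = "c ^ DIM('a)"
  have k: "0 < ?k" "?k \<le> 1"
    using S by (auto simp: power_le_one)
  \<comment> \<open>Balls are encoded as pairs of centre and radius, so that \<open>fst\<close> and
    \<open>snd\<close> can serve as the centre and radius functions of the covering theorem.\<close>
  let ?K = "{(x, d). 0 < d \<and> ball x d \<subseteq> V \<and> (\<exists>y. ball y (c * d) \<subseteq> ball x d - S)}"
  obtain C where C: "countable C" "C \<subseteq> ?K"
    and disj: "pairwise (\<lambda>i j. disjnt (ball (fst i) (snd i)) (ball (fst j) (snd j))) C"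
    and neg: "negligible (S - (\<Union>i\<in>C. ball (fst i) (snd i)))"
  proof (rule Vitali_covering_theorem_balls [of S ?K fst snd])
    fix x and e :: real
    assume x: "x \<in> S" and "e > 0"
    obtain r where r: "r > 0" "ball x r \<subseteq> V"
      using V x open_contains_ball by blast
    obtain d y where d: "0 < d" "d < min e r" "ball y (c * d) \<subseteq> ball x d - S"
      using S(1) x r \<open>e > 0\<close> unfolding porous_def by (metis min_less_iff_conj)
    have "ball x d \<subseteq> V"
      using d r subset_ball[of d r x] by auto
    then show "\<exists>i. i \<in> ?K \<and> x \<in> ball (fst i) (snd i) \<and> snd i < e"
      using d by (intro exI[of _ "(x, d)"]) auto
  qed
  have "\<forall>i\<in>C. \<exists>y. ball y (c * snd i) \<subseteq> ball (fst i) (snd i) - S"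
    using C by fastforce
  then obtain h where h: "\<And>i. i \<in> C \<Longrightarrow> ball (h i) (c * snd i) \<subseteq> ball (fst i) (snd i) - S"
    by metis
  define W where "W = (\<Union>i\<in>C. ball (fst i) (snd i))"
  define G where "G = (\<Union>i\<in>C. ball (h i) (c * snd i))"
  have pos: "snd i > 0" if "i \<in> C" for i
    using C that by fastforce
  have GW: "G \<subseteq> W" "G \<inter> S = {}"
    using h unfolding G_def W_def by blast+
  have WV: "W \<subseteq> V"
    using C unfolding W_def by fastforce
  have Wm: "W \<in> sets lebesgue" and Gm: "G \<in> sets lebesgue"
    unfolding W_def G_def by (simp_all add: lborelD open_UN)
  have W: "W \<in> lmeasurable" and G: "G \<in> lmeasurable"
    using fmeasurableI2[OF V(2) _ Wm] fmeasurableI2[OF V(2) _ Gm] WV GW by auto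
  have djW: "disjoint_family_on (\<lambda>i. ball (fst i) (snd i)) C"
    using disj unfolding disjoint_family_on_def pairwise_def disjnt_def by blast
  \<comment> \<open>Each hole lies in its own ball, so the holes inherit disjointness.\<close>
  have djG: "disjoint_family_on (\<lambda>i. ball (h i) (c * snd i)) C"
    unfolding disjoint_family_on_def
  proof (intro ballI impI)
    fix i j assume "i \<in> C" "j \<in> C" "i \<noteq> j"
    then show "ball (h i) (c * snd i) \<inter> ball (h j) (c * snd j) = {}"
      using djW h[of i] h[of j] unfolding disjoint_family_on_def by blast
  qed
  have vol: "emeasure lebesgue (ball (h i) (c * snd i)) =
      ennreal ?k * emeasure lebesgue (ball (fst i) (snd i))" if "i \<in> C" for i
    using pos[OF that] S
    by (simp add: emeasure_ball power_mult_distrib ennreal_mult[symmetric] mult.left_commute)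
  have "emeasure lebesgue G = (\<integral>\<^sup>+i. emeasure lebesgue (ball (h i) (c * snd i)) \<partial>count_space C)"
    unfolding G_def by (rule emeasure_UN_countable[OF _ C(1) djG]) auto
  also have "\<dots> = (\<integral>\<^sup>+i. ennreal ?k * emeasure lebesgue (ball (fst i) (snd i)) \<partial>count_space C)"
    by (rule nn_integral_cong) (simp only: vol space_count_space)
  also have "\<dots> = ennreal ?k * (\<integral>\<^sup>+i. emeasure lebesgue (ball (fst i) (snd i)) \<partial>count_space C)"
    by (rule nn_integral_cmult) auto
  also have "\<dots> = ennreal ?k * emeasure lebesgue W"
    unfolding W_def by (subst emeasure_UN_countable[OF _ C(1) djW]) auto
  finally have mG: "measure lebesgue G = ?k * measure lebesgue W"
    using k by (simp add: measure_def enn2real_mult)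
  let ?N = "S - W"
  have N: "?N \<in> lmeasurable" "measure lebesgue ?N = 0"
    using neg unfolding W_def by (auto simp: negligible_imp_measurable negligible_imp_measure0)
  \<comment> \<open>The holes miss \<open>S\<close>, so removing them keeps \<open>S\<close>
    covered. The null part of \<open>S\<close> outside the chosen balls is put back.\<close>
  define T where "T = (W - G) \<union> ?N"
  have T: "T \<in> lmeasurable"
    unfolding T_def by (rule fmeasurable.Un[OF fmeasurable_Diff[OF W fmeasurableD[OF G]] N(1)])
  have ST: "S \<subseteq> T"
    using GW unfolding T_def by blast
  have "measure lebesgue T \<le> measure lebesgue (W - G) + measure lebesgue ?N"
    unfolding T_def using W G N by (intro measure_Un_le) auto
  also have "\<dots> = (1 - ?k) * measure lebesgue W"
    using W G GW N mG by (simp add: measurable_measure_Diff left_diff_distrib)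
  also have "\<dots> \<le> (1 - ?k) * measure lebesgue V"
    using k WV V W by (intro mult_left_mono measure_mono_fmeasurable) auto
  finally have mT: "measure lebesgue T \<le> (1 - ?k) * measure lebesgue V" .
  obtain V' where "open V'" "T \<subseteq> V'" "V' \<in> lmeasurable"
     "measure lebesgue V' < measure lebesgue T + e"
    using lmeasurable_outer_open[OF T \<open>e > 0\<close>] by blast
  then show thesis
    using that[of V'] ST mT by simp
qed

text \<open>The infimum of the measures of open supersets cannot exceed
  \<open>1 - c ^ DIM('a)\<close> times itself, hence it vanishes. Cutting \<open>S\<close> down to a
  box guarantees an open superset of finite measure to start from.\<close>

lemma porous_imp_negligible:
  fixes S :: "'a::euclidean_space set"
  assumes S: "porous c S" "0 < c" "c \<le> 1"
  shows "negligible S"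
proof (subst negligible_on_intervals, intro allI)
  fix a b :: 'a
  let ?S = "S \<inter> cbox a b"
  have porous: "porous c ?S"
    using porous_subset[OF S(1)] by blast
  let ?q = "1 - c ^ DIM('a)"
  have q: "0 \<le> ?q" "?q < 1"
    using S by (auto simp: power_le_one)
  define X where "X = measure lebesgue ` {V. open V \<and> V \<in> lmeasurable \<and> ?S \<subseteq> V}"
  have bdd: "bdd_below X" and nonneg: "\<And>v. v \<in> X \<Longrightarrow> 0 \<le> v"
    unfolding X_def by (auto intro!: bdd_belowI[of _ 0])
  obtain V where "open V" "cbox a b \<subseteq> V" "V \<in> lmeasurable"
    using lmeasurable_outer_open[OF lmeasurable_cbox, of 1] by (metis zero_less_one)
  then have X: "X \<noteq> {}"
    unfolding X_def by blast
  have le: "Inf X \<le> ?q * v" if v: "v \<in> X" for v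
  proof (rule field_le_epsilon)
    fix e :: real assume "e > 0"
    obtain V where V: "open V" "V \<in> lmeasurable" "?S \<subseteq> V" "v = measure lebesgue V"
      using v unfolding X_def by blast
    obtain V' where "open V'" "V' \<in> lmeasurable" "?S \<subseteq> V'"
      "measure lebesgue V' \<le> ?q * measure lebesgue V + e"
      using porous_outer_step[OF porous S(2,3) V(1-3) \<open>e > 0\<close>] by blast
    moreover from this have "Inf X \<le> measure lebesgue V'"
      unfolding X_def by (intro cInf_lower bdd[unfolded X_def]) auto
    ultimately show "Inf X \<le> ?q * v + e"
      using V by simp
  qed
  have "Inf X \<le> ?q * Inf X"
  \<comment> \<open>The factor vanishes exactly for \<open>c = 1\<close>. Dividing by it is then
    impossible, but one application of the contraction already gives the bound.\<close>
  proof (cases "?q = 0")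
    case True
    then show ?thesis
      using le X by (metis ex_in_conv mult_zero_left)
  next
    case False
    then have "Inf X / ?q \<le> Inf X"
      using le q by (intro cInf_greatest X) (simp add: divide_le_eq mult.commute)
    with False q show ?thesis
      by (simp add: divide_le_eq mult.commute)
  qed
  then have "c ^ DIM('a) * Inf X \<le> 0"
    by (simp add: left_diff_distrib)
  then have Inf: "Inf X \<le> 0"
    using S by (meson mult_le_0_iff not_le zero_less_power)
  show "negligible ?S"
    unfolding negligible_outer
  proof (intro allI impI)
    fix e :: real assume "e > 0"
    then obtain v where "v \<in> X" "v < e"
      using Inf X cInf_lessD[of X e] by auto
    then show "\<exists>T. ?S \<subseteq> T \<and> T \<in> lmeasurable \<and> measure lebesgue T < e"
      unfolding X_def by blast
  qed
qed

text \<open>The first assumption makes every nonempty relatively open subset of \<open>D\<close>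
  contain a nonempty open set of the whole space. Without it, for instance, an isolated point of
  \<open>D\<close> would be relatively open although it may have empty interior in the whole
  space.\<close>

lemma nowhere_dense_in_top_of_set:
  assumes "D \<subseteq> closure (interior D)" "S \<subseteq> D" "interior (closure S) = {}"
  shows "nowhere_dense_in (top_of_set D) S"
proof -
  have "T = {}" if T: "openin (top_of_set D) T" "T \<subseteq> closure S" for T
  proof -
    obtain U where U: "open U" "T = D \<inter> U"
      using T(1) unfolding openin_open by blast
    have "interior D \<inter> U \<subseteq> interior (closure S)"
      using T U interior_subset by (intro interior_maximal) auto
    then have "U \<inter> closure (interior D) = {}"
      using assms(3) open_Int_closure_eq_empty[OF U(1)] by blast
    then show ?thesis
      using U assms(1) by blast
  qed
  then show ?thesis
    using assms(2) unfolding nowhere_dense_in_def interior_of_def closure_of_subtopology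
    by (auto simp: Int_absorb1)
qed

section \<open>The projection of a fixed point as a function of the direction\<close>

text \<open>Since 1 lies below \<open>pi / 3\<close>, the derivative \<open>cos t - 1 / 2\<close> of
  \<open>sin t - t / 2\<close> is nonnegative on the whole range.\<close>

lemma half_le_sin:
  fixes s :: real
  assumes "0 \<le> s" "s \<le> 1"
  shows "s / 2 \<le> sin s"
proof -
  have "sin 0 - 0 / 2 \<le> sin s - s / 2"
  proof (rule DERIV_nonneg_imp_nondecreasing[OF assms(1)])
    fix t :: real assume t: "0 \<le> t" "t \<le> s"
    have "cos (pi / 3) \<le> cos t"
      using t assms pi_gt3 by (intro cos_monotone_0_pi_le) auto
    then have "0 \<le> cos t - 1 / 2"
      by (simp add: cos_60)
    moreover have "((\<lambda>t. sin t - t / 2) has_real_derivative cos t - 1 / 2) (at t)"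
      by (auto intro!: derivative_eq_intros)
    ultimately show "\<exists>y. ((\<lambda>t. sin t - t / 2) has_real_derivative y) (at t) \<and> 0 \<le> y"
      by blast
  qed
  then show ?thesis by simp
qed

text \<open>The bracket is the coordinate of \<open>x\<close> orthogonal to the direction \<alpha>,
  that is, its projection in direction \<alpha> \<open>+ pi / 2\<close>.\<close>

lemma proj_add:
  "proj (\<alpha> + t) x = proj \<alpha> x * cos t + (x $ 2 * cos \<alpha> - x $ 1 * sin \<alpha>) * sin t"
  by (simp add: proj_def cos_add sin_add algebra_simps)

text \<open>Pythagoras in coordinates rotated by \<alpha>: a far point with small projection must
  have a large orthogonal coordinate.\<close>

lemma norm_eq_proj:
  "norm x ^ 2 = proj \<alpha> x ^ 2 + (x $ 2 * cos \<alpha> - x $ 1 * sin \<alpha>) ^ 2"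
proof -
  have "proj \<alpha> x ^ 2 + (x $ 2 * cos \<alpha> - x $ 1 * sin \<alpha>) ^ 2
      = ((x $ 1)^2 + (x $ 2)^2) * ((sin \<alpha>)^2 + (cos \<alpha>)^2)"
    unfolding proj_def by algebra
  then show ?thesis
    by (simp add: norm_vec_def L2_set_def sum_2)
qed

lemma proj_lipschitz: "\<bar>proj \<alpha> x - proj \<beta> x\<bar> \<le> 2 * norm x * \<bar>\<alpha> - \<beta>\<bar>"
proof -
  have lip: "\<bar>cos \<alpha> - cos \<beta>\<bar> \<le> \<bar>\<alpha> - \<beta>\<bar>" "\<bar>sin \<alpha> - sin \<beta>\<bar> \<le> \<bar>\<alpha> - \<beta>\<bar>"
    using field_differentiable_bound[of UNIV cos "\<lambda>x. - sin x" 1 \<alpha> \<beta>]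
      field_differentiable_bound[of UNIV sin cos 1 \<alpha> \<beta>]
    by (auto intro!: derivative_eq_intros)
  have "\<bar>proj \<alpha> x - proj \<beta> x\<bar> = \<bar>x $ 1 * (cos \<alpha> - cos \<beta>) + x $ 2 * (sin \<alpha> - sin \<beta>)\<bar>"
    by (simp add: proj_def algebra_simps)
  also have "\<dots> \<le> \<bar>x $ 1\<bar> * \<bar>cos \<alpha> - cos \<beta>\<bar> + \<bar>x $ 2\<bar> * \<bar>sin \<alpha> - sin \<beta>\<bar>"
    by (metis abs_triangle_ineq abs_mult)
  also have "\<dots> \<le> norm x * \<bar>\<alpha> - \<beta>\<bar> + norm x * \<bar>\<alpha> - \<beta>\<bar>"
    using lip by (intro add_mono mult_mono component_le_norm_cart) auto
  finally show ?thesis by simp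
qed

text \<open>A far point of the strip has an orthogonal coordinate of the order of its norm, so a
  turn of order \<open>1 / norm x\<close> sweeps its projection across the midpoint of the interval.
  The Lipschitz bound keeps the projection in the interval for a further range of directions of the
  same order. The ratio \<open>c\<close> depends only on \<open>K\<close>, \<open>a\<close> and
  \<open>b\<close>, not on the scale \<open>r\<close> or the point.\<close>

lemma proj_hits_interval:
  assumes "0 \<le> K" "a < b"
  obtains c where "0 < c" "c \<le> 1"
    "\<And>r. r > 0 \<Longrightarrow> \<exists>R. \<forall>x \<alpha>. R < norm x \<and> \<bar>proj \<alpha> x\<bar> \<le> K \<longrightarrow>
      (\<exists>d \<tau>. 0 < d \<and> d < r \<and> ball \<tau> (c * d) \<subseteq> ball \<alpha> d \<and>
        (\<forall>\<beta>\<in>ball \<tau> (c * d). proj \<beta> x \<in> {a<..<b}))"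
proof -
  define m where "m = (a + b) / 2"
  \<comment> \<open>With \<open>d = L / norm x\<close>, the bounds on the orthogonal coordinate and
    on the sine multiply to \<open>L / 8\<close>, which has to reach
    \<open>K + \<bar>m\<bar>\<close>. The summand \<open>b - a\<close> makes \<open>L\<close>
    positive and at least \<open>b - a\<close>, which keeps \<open>c\<close> below
    \<open>1 / 2\<close>.\<close>
  define L where "L = 8 * (K + \<bar>m\<bar> + (b - a))"
  define c where "c = (b - a) / (4 * L)"
  have L: "L > 0" "b - a \<le> L"
    using assms unfolding L_def by auto
  have c: "0 < c" "c \<le> 1 / 2" "c * L = (b - a) / 4"
    using L assms unfolding c_def by (auto simp: field_simps)
  have "\<exists>R. \<forall>x \<alpha>. R < norm x \<and> \<bar>proj \<alpha> x\<bar> \<le> K \<longrightarrow>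
      (\<exists>d \<tau>. 0 < d \<and> d < r \<and> ball \<tau> (c * d) \<subseteq> ball \<alpha> d \<and>
        (\<forall>\<beta>\<in>ball \<tau> (c * d). proj \<beta> x \<in> {a<..<b}))" if r: "r > 0" for r
  \<comment> \<open>The bound \<open>2 * K\<close> forces a large orthogonal coordinate,
    \<open>L\<close> gives \<open>d \<le> 1\<close> for the sine estimate, and \<open>L / r\<close>
    gives \<open>d < r\<close>.\<close>
  proof (rule exI[of _ "max (2 * K) (max L (L / r))"], intro allI impI)
    fix x \<alpha>
    assume asm: "max (2 * K) (max L (L / r)) < norm x \<and> \<bar>proj \<alpha> x\<bar> \<le> K"
    define d where "d = L / norm x"
    define z where "z = x $ 2 * cos \<alpha> - x $ 1 * sin \<alpha>"
    have x: "2 * K < norm x" "L < norm x" "L / r < norm x" "0 < norm x"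
      using asm L by auto
    have d: "0 < d" "d < r" "d \<le> 1" "norm x * d = L"
      using x L r unfolding d_def by (auto simp: field_simps)
    have "(norm x)^2 \<le> (\<bar>proj \<alpha> x\<bar> + \<bar>z\<bar>)^2"
      unfolding norm_eq_proj[of x \<alpha>] z_def by (simp add: power2_sum)
    then have "norm x \<le> \<bar>proj \<alpha> x\<bar> + \<bar>z\<bar>"
      by (rule power2_le_imp_le) simp
    then have z: "norm x / 2 \<le> \<bar>z\<bar>"
      using asm x by linarith
    have "norm x / 2 * (d / 2 / 2) \<le> \<bar>z\<bar> * sin (d / 2)"
      using d z half_le_sin[of "d / 2"] by (intro mult_mono) auto
    then have zs: "K + \<bar>m\<bar> \<le> \<bar>z\<bar> * sin (d / 2)"
      using d assms unfolding L_def by simp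
    have yc: "\<bar>proj \<alpha> x * cos (d / 2)\<bar> \<le> K"
      using asm mult_mono[of "\<bar>proj \<alpha> x\<bar>" K "\<bar>cos (d / 2)\<bar>" 1] assms by (simp add: abs_mult)
    have ends: "proj (\<alpha> + d / 2) x = proj \<alpha> x * cos (d / 2) + z * sin (d / 2)"
      "proj (\<alpha> - d / 2) x = proj \<alpha> x * cos (d / 2) - z * sin (d / 2)"
      using proj_add[of \<alpha> "d / 2" x] proj_add[of \<alpha> "- (d / 2)" x] by (simp_all add: z_def)
    have cont: "continuous_on A (\<lambda>\<beta>. proj \<beta> x)" for A
      unfolding proj_def by (intro continuous_intros)
    \<comment> \<open>Turning by \<open>d / 2\<close> either way moves the projection past
      \<open>m\<close> on opposite sides. The sign of \<open>z\<close> decides which end is the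
      lower one.\<close>
    have "\<exists>\<tau>. \<alpha> - d / 2 \<le> \<tau> \<and> \<tau> \<le> \<alpha> + d / 2 \<and> proj \<tau> x = m"
    proof (cases "0 \<le> z")
      case True
      then have "proj (\<alpha> - d / 2) x \<le> m" "m \<le> proj (\<alpha> + d / 2) x"
        using zs yc unfolding ends by auto
      then show ?thesis
        using d by (intro IVT'[where f = "\<lambda>\<beta>. proj \<beta> x"] cont) auto
    next
      case False
      then have "proj (\<alpha> + d / 2) x \<le> m" "m \<le> proj (\<alpha> - d / 2) x"
        using zs yc unfolding ends by auto
      then show ?thesis
        using d by (intro IVT2'[where f = "\<lambda>\<beta>. proj \<beta> x"] cont) auto
    qed
    then obtain \<tau> where \<tau>: "\<bar>\<tau> - \<alpha>\<bar> \<le> d / 2" "proj \<tau> x = m"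
      by (metis abs_le_iff add.commute diff_le_eq le_diff_eq minus_diff_eq)
    have "c * d \<le> 1 / 2 * d"
      using c d by (intro mult_right_mono) auto
    then have "dist \<tau> \<alpha> + c * d \<le> d"
      using \<tau>(1) by (simp add: dist_real_def)
    then have sub: "ball \<tau> (c * d) \<subseteq> ball \<alpha> d"
      by (simp add: ball_subset_ball_iff)
    have "proj \<beta> x \<in> {a<..<b}" if \<beta>: "\<beta> \<in> ball \<tau> (c * d)" for \<beta>
    proof -
      have "\<bar>proj \<beta> x - m\<bar> \<le> 2 * norm x * \<bar>\<beta> - \<tau>\<bar>"
        using proj_lipschitz[of \<beta> x \<tau>] \<tau> by simp
      also have "\<dots> < 2 * norm x * (c * d)"
        using \<beta> x by (intro mult_strict_left_mono) (auto simp: dist_real_def)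
      \<comment> \<open>The norm cancels here because \<open>norm x * d = L\<close>; the choice of
        \<open>c\<close> then makes the deviation from the midpoint less than half the length of the
        interval.\<close>
      also have "\<dots> = 2 * (c * (norm x * d))"
        by simp
      also have "\<dots> = (b - a) / 2"
        using d c by simp
      finally show ?thesis
        unfolding m_def by (auto simp: abs_less_iff field_simps)
    qed
    then show "\<exists>d \<tau>. 0 < d \<and> d < r \<and> ball \<tau> (c * d) \<subseteq> ball \<alpha> d \<and>
        (\<forall>\<beta>\<in>ball \<tau> (c * d). proj \<beta> x \<in> {a<..<b})"
      using d sub by blast
  qed
  then show thesis
    using that[of c] c by auto
qed

section \<open>Exceptional directions as a countable union of porous pieces\<close>

text \<open>The first condition witnesses the failure of P-boundedness, the second that of
  P-unboundedness. Fixing the radius \<open>n\<close> lets a single point beyond it exclude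
  directions from the piece.\<close>

definition PE_piece :: "(real ^ 2) set \<Rightarrow> real \<Rightarrow> real \<Rightarrow> real \<Rightarrow> real \<Rightarrow> real set" where
  "PE_piece M K n a b = {\<alpha> \<in> directions.
     (\<forall>R. \<exists>x\<in>M. R < norm x \<and> \<bar>proj \<alpha> x\<bar> \<le> K) \<and>
     (\<forall>x\<in>M. proj \<alpha> x \<in> {a<..<b} \<longrightarrow> norm x \<le> n)}"

lemma porous_PE_piece:
  assumes "0 \<le> K" "a < b"
  obtains c where "0 < c" "c \<le> 1" "porous c (PE_piece M K n a b)"
proof -
  obtain c where c: "0 < c" "c \<le> 1"
    and hit: "\<And>r. r > 0 \<Longrightarrow> \<exists>R. \<forall>x \<alpha>. R < norm x \<and> \<bar>proj \<alpha> x\<bar> \<le> K \<longrightarrow>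
      (\<exists>d \<tau>. 0 < d \<and> d < r \<and> ball \<tau> (c * d) \<subseteq> ball \<alpha> d \<and>
        (\<forall>\<beta>\<in>ball \<tau> (c * d). proj \<beta> x \<in> {a<..<b}))"
    using proj_hits_interval[OF assms] by blast
  have "\<exists>d \<tau>. 0 < d \<and> d < r \<and> ball \<tau> (c * d) \<subseteq> ball \<alpha> d - PE_piece M K n a b"
    if \<alpha>: "\<alpha> \<in> PE_piece M K n a b" and "r > 0" for \<alpha> r
  proof -
    obtain R where R: "\<And>x \<alpha>. R < norm x \<Longrightarrow> \<bar>proj \<alpha> x\<bar> \<le> K \<Longrightarrow>
      (\<exists>d \<tau>. 0 < d \<and> d < r \<and> ball \<tau> (c * d) \<subseteq> ball \<alpha> d \<and>
        (\<forall>\<beta>\<in>ball \<tau> (c * d). proj \<beta> x \<in> {a<..<b}))"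
      using hit[OF \<open>r > 0\<close>] by blast
    \<comment> \<open>Beyond \<open>R\<close> the point has a range of directions projecting it into
      the interval; beyond \<open>n\<close> each of these directions violates the second condition
      of the piece.\<close>
    obtain x where x: "x \<in> M" "max R n < norm x" "\<bar>proj \<alpha> x\<bar> \<le> K"
      using \<alpha> unfolding PE_piece_def by blast
    then obtain d \<tau> where d: "0 < d" "d < r" "ball \<tau> (c * d) \<subseteq> ball \<alpha> d"
      "\<forall>\<beta>\<in>ball \<tau> (c * d). proj \<beta> x \<in> {a<..<b}"
      using R[of x \<alpha>] by auto
    have "\<beta> \<notin> PE_piece M K n a b" if "\<beta> \<in> ball \<tau> (c * d)" for \<beta>
      using d(4) that x unfolding PE_piece_def by fastforce
    then show ?thesis
      using d by blast
  qed
  then show thesis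
    using that[of c] c unfolding porous_def by blast
qed

text \<open>An unbounded preimage stays unbounded when the bounded set is enlarged to a strip of
  natural half-width, and a bounded one stays bounded when the open set is shrunk to a rational
  interval. Hence countably many parameters suffice.\<close>

lemma PE_eq_Union_pieces:
  "PE M = (\<Union>(K, n, a, b) \<in> {(K, n, a, b). K \<in> \<nat> \<and> n \<in> \<nat> \<and> a \<in> \<rat> \<and> b \<in> \<rat> \<and> a < b}. PE_piece M K n a b)"
  (is "_ = ?U")
proof (intro equalityI subsetI)
  fix \<alpha> assume "\<alpha> \<in> PE M"
  then obtain I J where \<alpha>: "\<alpha> \<in> directions"
    and I: "bounded I" "\<not> bounded (proj \<alpha> -` I \<inter> M)"
    and J: "open J" "J \<noteq> {}" "bounded (proj \<alpha> -` J \<inter> M)"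
    unfolding PE_def PB_def PUB_def by blast
  obtain B where B: "\<And>y. y \<in> I \<Longrightarrow> \<bar>y\<bar> \<le> B"
    using I(1) unfolding bounded_iff by auto
  obtain K :: nat where K: "B \<le> real K"
    using real_arch_simple by blast
  obtain B' where B': "\<And>x. x \<in> M \<Longrightarrow> proj \<alpha> x \<in> J \<Longrightarrow> norm x \<le> B'"
    using J(3) unfolding bounded_iff by auto
  obtain n :: nat where n: "B' \<le> real n"
    using real_arch_simple by blast
  obtain y e where y: "e > 0" "ball y e \<subseteq> J"
    using J open_contains_ball by blast
  obtain a where a: "a \<in> \<rat>" "y - e < a" "a < y"
    using Rats_dense_in_real[of "y - e" y] y by auto
  obtain b where b: "b \<in> \<rat>" "y < b" "b < y + e"
    using Rats_dense_in_real[of y "y + e"] y by auto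
  have "{a<..<b} \<subseteq> ball y e"
    using a b by (auto simp: dist_real_def)
  then have ab: "{a<..<b} \<subseteq> J"
    using y by blast
  have "\<exists>x\<in>M. R < norm x \<and> \<bar>proj \<alpha> x\<bar> \<le> real K" for R
  proof -
    obtain x where "x \<in> M" "proj \<alpha> x \<in> I" "R < norm x"
      using I(2) unfolding bounded_iff by (auto simp: not_le)
    then show ?thesis
      using B K order_trans by blast
  qed
  moreover have "\<forall>x\<in>M. proj \<alpha> x \<in> {a<..<b} \<longrightarrow> norm x \<le> real n"
    using B' ab n by (meson order_trans subsetD)
  ultimately have "\<alpha> \<in> PE_piece M (real K) (real n) a b"
    using \<alpha> unfolding PE_piece_def by blast
  then show "\<alpha> \<in> ?U"
    using a b by (intro UN_I[of "(real K, real n, a, b)"]) auto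
next
  fix \<alpha> assume "\<alpha> \<in> ?U"
  then obtain K n a b where ab: "a < b" and \<alpha>: "\<alpha> \<in> PE_piece M K n a b"
    by auto
  have "bounded (proj \<alpha> -` {a<..<b} \<inter> M)"
    using \<alpha> unfolding PE_piece_def by (auto intro!: boundedI[of _ n])
  moreover have "open {a<..<b}" "{a<..<b} \<noteq> {}"
    using ab by auto
  ultimately have "\<alpha> \<notin> PUB M"
    unfolding PUB_def by blast
  moreover have "\<not> bounded (proj \<alpha> -` {-K..K} \<inter> M)"
  proof
    assume "bounded (proj \<alpha> -` {-K..K} \<inter> M)"
    then obtain R where "\<And>x. x \<in> M \<Longrightarrow> \<bar>proj \<alpha> x\<bar> \<le> K \<Longrightarrow> norm x \<le> R"
      unfolding bounded_iff by fastforce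
    moreover obtain x where "x \<in> M" "R < norm x" "\<bar>proj \<alpha> x\<bar> \<le> K"
      using \<alpha> unfolding PE_piece_def by blast
    ultimately show False
      by (meson not_le)
  qed
  then have "\<alpha> \<notin> PB M"
    unfolding PB_def using bounded_closed_interval by blast
  ultimately show "\<alpha> \<in> PE M"
    using \<alpha> unfolding PE_def PE_piece_def by blast
qed

theorem theorem1p2:
  fixes M :: "(real ^ 2) set"
  shows "meager_in (top_of_set directions) (PE M) \<and> PE M \<in> null_sets lebesgue"
proof -
  define I :: "(real \<times> real \<times> real \<times> real) set"
    where "I = {(K, n, a, b). K \<in> \<nat> \<and> n \<in> \<nat> \<and> a \<in> \<rat> \<and> b \<in> \<rat> \<and> a < b}"
  define \<F> where "\<F> = (\<lambda>(K, n, a, b). PE_piece M K n a b) ` I"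
  have "countable (\<nat> \<times> \<nat> \<times> \<rat> \<times> \<rat> :: (real \<times> real \<times> real \<times> real) set)"
    by (intro countable_SIGMA countable_rat) (auto simp: Nats_def)
  then have "countable I"
    by (rule countable_subset[rotated]) (auto simp: I_def)
  then have count: "countable \<F>"
    unfolding \<F>_def by blast
  have PE: "PE M = \<Union>\<F>"
    unfolding PE_eq_Union_pieces \<F>_def I_def ..
  \<comment> \<open>The constant may vary with the piece, since nowhere density and nullity are both
    obtained piece by piece.\<close>
  have porous: "\<exists>c. 0 < c \<and> c \<le> 1 \<and> porous c B" if B: "B \<in> \<F>" for B
  proof -
    obtain K n a b where "0 \<le> K" "a < b" "B = PE_piece M K n a b"
      using B unfolding \<F>_def I_def by (auto simp: Nats_altdef2 Ints_def elim!: Nats_cases)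
    then show ?thesis
      using porous_PE_piece[of K a b M n] by blast
  qed
  \<comment> \<open>This takes care of the endpoint 0, which is a direction but not an interior
    one.\<close>
  have dir: "directions \<subseteq> closure (interior directions)"
    by (auto simp: directions_def closure_greaterThanLessThan)
  have "nowhere_dense_in (top_of_set directions) B" if B: "B \<in> \<F>" for B
  proof (rule nowhere_dense_in_top_of_set[OF dir])
    show "B \<subseteq> directions"
      using B unfolding \<F>_def PE_piece_def by auto
    show "interior (closure B) = {}"
      using porous[OF B] porous_imp_interior_closure_empty by blast
  qed
  then have "meager_in (top_of_set directions) (PE M)"
    unfolding meager_in_def using count PE by blast
  moreover have "negligible (PE M)"
    unfolding PE using count porous porous_imp_negligible by (intro negligible_countable_Union) blast+
  ultimately show ?thesis
    by (simp add: negligible_iff_null_sets)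
qed

end
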